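(* Let $r,s\ge 1$ be integers such that $k=r+s\ge 3$ is odd. (i) If $s\ge 2$, then $$\zeta(\overline{r},s)=-\frac12\zeta(\overline{k})+\frac{1+(-1)^s}{2}\zeta(\overline{r})\zeta(s)+(-1)^r\sum_{l=0}^{\frac{k-1}{2}}\left[\binom{k-2l-1}{r-1}\zeta(\overline{k-2l})+\binom{k-2l-1}{s-1}\zeta(k-2l)\right]\zeta(\overline{2l}).$$ (ii) If $r\ge 2$, then $$\zeta(r,\overline{s})=-\frac12\zeta(\overline{k})+\frac{1+(-1)^s}{2}\zeta(r)\zeta(\overline{s})+(-1)^r\sum_{l=0}^{\frac{k-1}{2}}\left[\binom{k-2l-1}{r-1}\zeta(k-2l)+\binom{k-2l-1}{s-1}\zeta(\overline{k-2l})\right]\zeta(\overline{2l}),$$ while if $r=1$, then $$\zeta(r,\overline{s})=-\frac12\zeta(\overline{k})+(-1)^r\left[\sum_{l=0}^{\frac{k-3}{2}}\binom{k-2l-1}{r-1}\zeta(k-2l)\zeta(\overline{2l})+\sum_{l=0}^{\frac{k-1}{2}}\binom{k-2l-1}{s-1}\zeta(\overline{k-2l})\zeta(\overline{2l})\right].$$ (iii) For all such $r,s\ge 1$, $$\zeta(\overline{r},\overline{s})=-\frac12\zeta(k)+\frac{1+(-1)^s}{2}\zeta(\overline{r})\zeta(\overline{s})+(-1)^r\sum_{l=0}^{\frac{k-1}{2}}\left[\binom{k-2l-1}{r-1}\zeta(\overline{k-2l})+\binom{k-2l-1}{s-1}\zeta(\overline{k-2l})\right]\zeta(2l).$$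
   Context: $\zeta(n)$ denotes the Riemann zeta value for $n\ge2$, and $\zeta(\overline{n})=\sum_{m=1}^\infty\frac{(-1)^m}{m^n}$ for $n\ge1$; moreover $\zeta(0)=\zeta(\overline{0})=-\frac12$. The alternating double Euler sums are $$\zeta(\overline{r},s)=\sum_{m=2}^{\infty}\frac{1}{m^s}\sum_{j=1}^{m-1}\frac{(-1)^j}{j^r},\quad \zeta(r,\overline{s})=\sum_{m=2}^{\infty}\frac{(-1)^m}{m^s}\sum_{j=1}^{m-1}\frac{1}{j^r},\quad \zeta(\overline{r},\overline{s})=\sum_{m=2}^{\infty}\frac{(-1)^m}{m^s}\sum_{j=1}^{m-1}\frac{(-1)^j}{j^r},$$ where the first requires $s\ge2$ for convergence and the other two are (possibly conditionally) convergent for all $r,s\ge1$. Conventions: $\binom{n}{m}=0$ if $m>n\ge 0$; a term whose binomial coefficient, or whose coefficient $\frac{1+(-1)^s}{2}$, is zero is read as $0$, even if it formally multiplies the undefined symbol $\zeta(1)$. *)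

theory Defs
  imports "HOL-Analysis.Analysis"
begin

text \<open>
  Convention: the value at \<open>0\<close> is \<open>-1/2\<close>. At \<open>n = 1\<close> the series diverges, so \<open>zeta_val 1\<close> is
  an unspecified real number. The symbol may only occur multiplied by a vanishing coefficient,
  so that the product is \<open>0\<close> whatever its value.
\<close>

definition zeta_val :: "nat \<Rightarrow> real" where
  "zeta_val n = (if n = 0 then - 1 / 2 else (\<Sum>m. 1 / real (m + 1) ^ n))"

text \<open>
  The value at a barred argument. The series is only conditionally convergent for \<open>n = 1\<close>;
  \<open>suminf\<close> is the limit of the partial sums in the natural order.
\<close>

definition zeta_bar :: "nat \<Rightarrow> real" where
  "zeta_bar n = (if n = 0 then - 1 / 2 else (\<Sum>m. (- 1) ^ (m + 1) / real (m + 1) ^ n))"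

text \<open>
  Alternating double sums with \<open>1 \<le> j < m\<close>: the letter \<open>b\<close> marks a barred argument and \<open>u\<close> an
  unbarred one, in the order of the arguments \<open>r\<close> (inner index \<open>j\<close>) and \<open>s\<close> (outer index \<open>m\<close>).
  The outer index, which starts at 2, is shifted to \<open>m + 2\<close>, so the inner one runs up to \<open>m + 1\<close>.
\<close>

definition dzeta_bu :: "nat \<Rightarrow> nat \<Rightarrow> real" where
  "dzeta_bu r s =
     (\<Sum>m. 1 / real (m + 2) ^ s * (\<Sum>j = 1..m + 1. (- 1) ^ j / real j ^ r))"

definition dzeta_ub :: "nat \<Rightarrow> nat \<Rightarrow> real" where
  "dzeta_ub r s =
     (\<Sum>m. (- 1) ^ (m + 2) / real (m + 2) ^ s * (\<Sum>j = 1..m + 1. 1 / real j ^ r))"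

definition dzeta_bb :: "nat \<Rightarrow> nat \<Rightarrow> real" where
  "dzeta_bb r s =
     (\<Sum>m. (- 1) ^ (m + 2) / real (m + 2) ^ s * (\<Sum>j = 1..m + 1. (- 1) ^ j / real j ^ r))"

end

theory Submission
  imports Defs "HOL-Real_Asymp.Real_Asymp"
begin

text \<open>
  Let \<open>x\<close> and \<open>y\<close> be the signs attached to the inner and the outer summation variable. The
  double sums \<open>D(x,r;y,s)\<close> and \<open>D(y,s;x,r)\<close> satisfy two linear relations. The stuffle product gives
  their sum. For their difference (\<open>k\<close> is odd), consider, for \<open>j \<ge> 1\<close>, the sum of
  \<open>x\<^sup>j (x y)\<^sup>n / (n\<^sup>s (n - j)\<^sup>r)\<close> over all integers \<open>n \<noteq> 0, j\<close>. The ranges \<open>n > j\<close> and \<open>n < 0\<close>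
  contribute the two double sums and \<open>0 < n < j\<close> contributes the product of two single
  sums, while partial fractions and the symmetry \<open>n \<mapsto> -n\<close> express everything through even
  values \<open>\<zeta>(2l)\<close> times single sums. Truncating to \<open>j, \<bar>n\<bar>, \<bar>n - j\<bar> \<le> N\<close>
  treats the conditionally convergent cases on the same footing: every error term is bounded by
  a multiple of \<open>\<Sum>\<^sub>j 1 / (j (N + 1 - j))\<close>, which tends to \<open>0\<close>.
\<close>

section \<open>Truncated single and double sums with signs\<close>

definition zpart :: "real \<Rightarrow> nat \<Rightarrow> nat \<Rightarrow> real" where
  "zpart x N i = (\<Sum>j = 1..N. x ^ j / real j ^ i)"

definition dpart :: "real \<Rightarrow> nat \<Rightarrow> real \<Rightarrow> nat \<Rightarrow> nat \<Rightarrow> real" where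
  "dpart x r y s N = (\<Sum>m = 1..N. y ^ m / real m ^ s * (\<Sum>a = 1..<m. x ^ a / real a ^ r))"

text \<open>One function covers \<open>zeta_val\<close> and \<open>zeta_bar\<close>, so that all
  sign patterns share one proof. The value \<open>- 1 / 2\<close> at \<open>0\<close> later turns
  the contribution of the excluded points \<open>n = j\<close> into the summand
  \<open>l = 0\<close>.\<close>

definition zlim :: "real \<Rightarrow> nat \<Rightarrow> real" where
  "zlim x i = (if i = 0 then - 1 / 2 else (\<Sum>m. x ^ (m + 1) / real (m + 1) ^ i))"

lemma zlim_one: "zlim 1 = zeta_val"
  by (rule ext) (simp add: zlim_def zeta_val_def)

lemma zlim_minus_one: "zlim (- 1) = zeta_bar"
  by (rule ext) (simp add: zlim_def zeta_bar_def)

lemma zpart_Suc: "zpart x (Suc N) i = zpart x N i + x ^ Suc N / real (Suc N) ^ i"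
  by (simp add: zpart_def)

lemma zpart_eq_lessThan: "zpart x N i = (\<Sum>m<N. x ^ (m + 1) / real (m + 1) ^ i)"
  by (induction N) (simp_all add: zpart_def)

lemma zpart_tendsto:
  assumes "x = 1 \<or> x = - 1" "i \<ge> 2 \<or> i = 1 \<and> x = - 1"
  shows "(\<lambda>N. zpart x N i) \<longlonglongrightarrow> zlim x i"
proof -
  have "summable (\<lambda>m. x ^ (m + 1) / real (m + 1) ^ i)"
  proof (cases "i \<ge> 2")
    case True
    have "summable (\<lambda>m. inverse (real (Suc m) ^ i))"
      using inverse_power_summable[OF True, where 'a = real] by (subst summable_Suc_iff)
    then show ?thesis
      by (rule summable_comparison_test'[where N = 0])
        (use assms in \<open>auto simp: norm_mult norm_divide norm_power power_abs field_simps\<close>)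
  next
    case False
    then have i: "i = 1" "x = - 1"
      using assms by auto
    have "summable (\<lambda>m. (- 1) ^ m * (1 / real (m + 1)))"
    proof (rule summable_Leibniz(1))
      show "(\<lambda>m. 1 / real (m + 1)) \<longlonglongrightarrow> 0" by real_asymp
      show "monoseq (\<lambda>m. 1 / real (m + 1))"
        by (rule monoI2) (auto simp: field_simps)
    qed
    from summable_minus[OF this] show ?thesis
      using i by simp
  qed
  then show ?thesis
    using assms by (auto simp: zpart_eq_lessThan zlim_def dest!: summable_LIMSEQ)
qed

text \<open>Telescoping: the new term is at most \<open>1 / n ^ 2\<close>, hence at most
  \<open>2 / (n * (n + 1)) = 2 / n - 2 / (n + 1)\<close>.\<close>

lemma zpart_diff_bound:
  assumes "\<bar>x\<bar> = 1" "i \<ge> 2"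
  shows "\<bar>zpart x (N + d) i - zpart x N i\<bar> \<le> 2 / real (N + 1) - 2 / real (N + d + 1)"
proof (induction d)
  case (Suc d)
  define M where "M = N + d"
  have "\<bar>x ^ Suc M / real (Suc M) ^ i\<bar> = 1 / real (Suc M) ^ i"
    using assms by (simp add: abs_mult power_abs)
  also have "\<dots> \<le> 1 / real (Suc M) ^ 2"
    using assms by (intro divide_left_mono power_increasing) auto
  also have "\<dots> = 2 / (real (Suc M) * (2 * real (Suc M)))"
    by (simp add: power2_eq_square del: of_nat_Suc)
  also have "\<dots> \<le> 2 / (real (Suc M) * real (Suc M + 1))"
    by (intro divide_left_mono mult_left_mono mult_pos_pos) auto
  also have "\<dots> = 2 / real (M + 1) - 2 / real (M + 2)"
    by (simp add: field_simps)
  finally have "\<bar>x ^ Suc M / real (Suc M) ^ i\<bar> \<le> 2 / real (M + 1) - 2 / real (M + 2)" .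
  moreover have "zpart x (N + Suc d) i = zpart x M i + x ^ Suc M / real (Suc M) ^ i"
    by (simp only: M_def add_Suc_right zpart_Suc)
  moreover have "N + Suc d + 1 = M + 2" "N + d = M"
    by (simp_all add: M_def)
  ultimately show ?case
    using Suc by (simp only:)
qed simp

text \<open>The explicit rate matters: it yields the factor \<open>1 / (N + 1 - j)\<close> in
  \<open>slice_error_bound\<close>, and for \<open>r = 1\<close> it has to beat the growth of the
  harmonic sum.\<close>

lemma zpart_tail_bound:
  assumes "x = 1 \<or> x = - 1" "i \<ge> 2"
  shows "\<bar>zpart x N i - zlim x i\<bar> \<le> 2 / real (N + 1)"
proof -
  have "(\<lambda>d. zpart x (N + d) i) \<longlonglongrightarrow> zlim x i"
    using LIMSEQ_ignore_initial_segment[OF zpart_tendsto[of x i], of N] assms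
    by (simp add: add.commute)
  then have "(\<lambda>d. \<bar>zpart x (N + d) i - zpart x N i\<bar>) \<longlonglongrightarrow> \<bar>zlim x i - zpart x N i\<bar>"
    by (intro tendsto_intros)
  moreover have "\<bar>zpart x (N + d) i - zpart x N i\<bar> \<le> 2 / real (N + 1)" for d
    by (rule order.trans[OF zpart_diff_bound]) (use assms in auto)
  ultimately have "\<bar>zlim x i - zpart x N i\<bar> \<le> 2 / real (N + 1)"
    by (intro Lim_bounded) auto
  then show ?thesis
    by (simp add: abs_minus_commute)
qed

section \<open>Partial fractions\<close>

text \<open>
  With \<open>u = 1/a\<close>, \<open>v = 1/b\<close>, \<open>w = 1/(a + b)\<close>, this is the part of the partial fraction expansion of
  \<open>u\<^sup>p\<^sup>+\<^sup>1 v\<^sup>q\<^sup>+\<^sup>1\<close> with poles at \<open>b = 0\<close>.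
\<close>

definition pfsum :: "real \<Rightarrow> nat \<Rightarrow> nat \<Rightarrow> real \<Rightarrow> real" where
  "pfsum w p q v = (\<Sum>t\<le>p + q. w ^ (t + 1) * real (t choose p) * v ^ (p + q + 1 - t))"

lemma pfsum_0_0: "pfsum w 0 0 v = w * v"
  by (simp add: pfsum_def)

lemma pfsum_0_Suc: "pfsum w 0 (Suc q) v = w * v ^ (q + 2) + w * pfsum w 0 q v"
  by (simp add: pfsum_def sum.atMost_Suc_shift sum_distrib_left mult_ac del: sum.atMost_Suc)

lemma pfsum_Suc_0: "pfsum w (Suc p) 0 v = w * pfsum w p 0 v"
proof -
  have "pfsum w p 0 v = w ^ (p + 1) * v" for p
  proof -
    \<comment> \<open>The pole is simple here: \<open>t choose p\<close> with
      \<open>t \<le> p\<close> vanishes except at \<open>t = p\<close>.\<close>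
    have "pfsum w p 0 v = (\<Sum>t\<in>{p}. w ^ (t + 1) * real (t choose p) * v ^ (p + 1 - t))"
      unfolding pfsum_def by (rule sum.mono_neutral_cong_right) (auto simp: binomial_eq_0)
    then show ?thesis by simp
  qed
  then show ?thesis by simp
qed

text \<open>Pascal's rule, after dropping the summand \<open>t = 0\<close>, whose binomial
  coefficient is zero.\<close>

lemma pfsum_Suc_Suc:
  "pfsum w (Suc p) (Suc q) v = w * (pfsum w (Suc p) q v + pfsum w p (Suc q) v)"
proof -
  have "pfsum w (Suc p) (Suc q) v =
    (\<Sum>t\<le>p + q + 1. w ^ (t + 2) * real (Suc t choose Suc p) * v ^ (p + q + 2 - t))"
    by (simp add: pfsum_def sum.atMost_Suc_shift del: sum.atMost_Suc binomial_Suc_Suc)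
  also have "\<dots> = w * (pfsum w (Suc p) q v + pfsum w p (Suc q) v)"
    by (simp add: pfsum_def sum_distrib_left distrib_left distrib_right mult_ac add_ac
        flip: sum.distrib del: sum.atMost_Suc)
  finally show ?thesis .
qed

text \<open>The hypothesis is \<open>1/(a b) = (1/a + 1/b)/(a + b)\<close>. Applied to one factor
  \<open>u * v\<close>, it lowers either exponent by one, which drives an induction on
  \<open>p + q\<close>. An exponent that reaches \<open>0\<close> leaves a pure power, the extra
  term in \<open>pfsum_0_Suc\<close>.\<close>

lemma mult_powers_eq_pfsum:
  assumes "u * v = w * (u + v :: real)"
  shows "u ^ (p + 1) * v ^ (q + 1) = pfsum w p q v + pfsum w q p u"
proof -
  have step: "u ^ (p + 1) * v ^ (q + 1) = w * (u ^ p * v ^ (q + 1) + u ^ (p + 1) * v ^ q)" for p q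
  proof -
    have "u ^ (p + 1) * v ^ (q + 1) = u ^ p * v ^ q * (u * v)" by simp
    then show ?thesis unfolding assms by (simp add: algebra_simps)
  qed
  show ?thesis
  proof (induction "p + q" arbitrary: p q)
    case 0
    then show ?case using assms by (simp add: pfsum_0_0 algebra_simps)
  next
    case (Suc n)
    have IH: "u ^ (p' + 1) * v ^ (q' + 1) = pfsum w p' q' v + pfsum w q' p' u"
      if "p' + q' = n" for p' q'
      using Suc(1) that by simp
    show ?case
    proof (cases p)
      case 0
      then obtain q' where "q = Suc q'" using Suc by (cases q) auto
      then show ?thesis
        using IH[of 0 q'] Suc(2) 0
        by (subst step) (simp add: pfsum_0_Suc pfsum_Suc_0 algebra_simps)
    next
      case p: (Suc p')
      show ?thesis
      proof (cases q)
        case 0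
        then show ?thesis
          using IH[of p' 0] Suc(2) p
          by (subst step) (simp add: pfsum_0_Suc pfsum_Suc_0 algebra_simps)
      next
        case (Suc q')
        then show ?thesis
          using IH[of p' q] IH[of p q'] \<open>Suc n = p + q\<close> p
          by (subst step) (simp add: pfsum_Suc_Suc algebra_simps)
      qed
    qed
  qed
qed

lemma partial_fractions:
  fixes a b c :: real
  assumes "a + b = c" "a \<noteq> 0" "b \<noteq> 0" "c \<noteq> 0" "r \<ge> 1" "s \<ge> 1" "k = r + s"
  shows "1 / (a ^ r * b ^ s) =
    (\<Sum>i = 1..k - 1. (real ((k - i - 1) choose (r - 1)) / b ^ i
                     + real ((k - i - 1) choose (s - 1)) / a ^ i) / c ^ (k - i))"
proof -
  define u v w where "u = 1 / a" "v = 1 / b" "w = 1 / c"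
  have uvw: "u * v = w * (u + v)"
    using assms unfolding u_v_w_def by (simp add: field_simps)
  define p q where "p = r - 1" "q = s - 1"
  have rs: "r = p + 1" "s = q + 1" "k = p + q + 2" using assms p_q_def by auto
  have "1 / (a ^ r * b ^ s) = u ^ r * v ^ s"
    by (simp add: u_v_w_def power_divide)
  also have "\<dots> = pfsum w p q v + pfsum w q p u"
    unfolding rs by (rule mult_powers_eq_pfsum[OF uvw])
  also have "\<dots> = (\<Sum>t\<le>p + q. (real (t choose p) * v ^ (p + q + 1 - t)
                     + real (t choose q) * u ^ (p + q + 1 - t)) * w ^ (t + 1))"
    by (simp add: pfsum_def add.commute[of q p] algebra_simps sum.distrib)
  \<comment> \<open>The substitution \<open>t = k - 1 - i\<close> sorts the terms by pole order
    \<open>i\<close>.\<close>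
  also have "\<dots> = (\<Sum>i = 1..k - 1. (real ((k - i - 1) choose p) * v ^ i
                     + real ((k - i - 1) choose q) * u ^ i) * w ^ (k - i))"
    by (rule sum.reindex_bij_witness[of _ "\<lambda>i. k - 1 - i" "\<lambda>t. k - 1 - t"])
      (auto simp: rs Suc_diff_le)
  finally show ?thesis
    by (simp add: u_v_w_def p_q_def power_divide)
qed

section \<open>Exact rearrangements of finite double sums\<close>

text \<open>The pairs \<open>1 \<le> a < m \<le> N\<close> are sorted by their difference
  \<open>j = m - a\<close>.\<close>

lemma sum_offset_triangle:
  fixes f :: "nat \<Rightarrow> nat \<Rightarrow> real"
  shows "(\<Sum>j = 1..N. \<Sum>a = 1..N - j. f a (a + j)) = (\<Sum>m = 1..N. \<Sum>a = 1..<m. f a m)"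
  unfolding sum.Sigma[OF finite_atLeastAtMost ballI[OF finite_atLeastAtMost]]
    sum.Sigma[OF finite_atLeastAtMost ballI[OF finite_atLeastLessThan]]
  by (rule sum.reindex_bij_witness[of _ "\<lambda>(m, a). (m - a, a)" "\<lambda>(j, a). (a + j, a)"]) auto

text \<open>The square of index pairs consists of two triangles and the diagonal. The relation is
  exact for each \<open>N\<close>, so divergent factors do no harm.\<close>

lemma dpart_stuffle:
  "dpart x r y s N + dpart y s x r N + zpart (x * y) N (r + s) = zpart x N r * zpart y N s"
proof (induction N)
  case 0
  then show ?case by (simp add: dpart_def zpart_def)
next
  case (Suc N)
  have *: "dpart x r y s (Suc N) = dpart x r y s N + y ^ Suc N / real (Suc N) ^ s * zpart x N r"
    for x r y s
    unfolding dpart_def zpart_def by (simp add: atLeastLessThanSuc_atLeastAtMost)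
  have "(x * y) ^ Suc N / real (Suc N) ^ (r + s)
    = (x ^ Suc N / real (Suc N) ^ r) * (y ^ Suc N / real (Suc N) ^ s)"
    by (simp add: power_mult_distrib power_add)
  with Suc show ?case
    unfolding * zpart_Suc by (simp only:) (simp only: algebra_simps)
qed

section \<open>The error term \<open>convsum\<close>\<close>

text \<open>A bound cruder than the logarithm: it is only ever divided by \<open>N + 1\<close>, so
  any sublinear growth suffices.\<close>

lemma sum_inverse_le_sqrt: "(\<Sum>j = 1..N. 1 / real j) \<le> 2 * sqrt (real N)"
proof (induction N)
  case (Suc N)
  define a b where "a = sqrt (real N)" "b = sqrt (real (Suc N))"
  have ab: "0 \<le> a" "a \<le> b" "b > 0" "a\<^sup>2 = real N" "b\<^sup>2 = real N + 1"
    by (simp_all add: a_b_def)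
  have "a * b \<le> b * b" using ab by (intro mult_right_mono) auto
  \<comment> \<open>This uses \<open>b\<^sup>2 - a\<^sup>2 = 1\<close>.\<close>
  have "2 * b * b - 1 - 2 * a * b = (b - a)\<^sup>2"
    using ab by (simp add: power2_eq_square algebra_simps)
  then have "1 \<le> (2 * b - 2 * a) * b"
    using zero_le_power2[of "b - a"] by (simp add: algebra_simps)
  then have "1 / b \<le> 2 * b - 2 * a"
    using ab by (simp add: pos_divide_le_eq)
  moreover have "1 \<le> b"
    by (simp add: a_b_def)
  then have "1 / b\<^sup>2 \<le> 1 / b"
    by (simp add: power2_eq_square divide_simps)
  ultimately have "1 / b\<^sup>2 \<le> 2 * b - 2 * a"
    by linarith
  then have "1 / real (Suc N) \<le> 2 * b - 2 * a"
    using ab by (simp add: add.commute)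
  then show ?case
    using Suc by (simp add: a_b_def)
qed simp

definition convsum :: "nat \<Rightarrow> real" where
  "convsum N = (\<Sum>j = 1..N. 1 / (real j * real (N + 1 - j)))"

text \<open>The two factors in each denominator add up to \<open>N + 1\<close>, so partial fractions
  give twice the harmonic sum divided by \<open>N + 1\<close>.\<close>

lemma convsum_tendsto_0: "convsum \<longlonglongrightarrow> 0"
proof (rule tendsto_sandwich[where f = "\<lambda>_. 0"])
  have "convsum N \<le> 4 * sqrt (real N) / real (N + 1)" for N
  proof -
    have "convsum N = (\<Sum>j = 1..N. (1 / real j + 1 / real (N + 1 - j)) / real (N + 1))"
      unfolding convsum_def
    proof (intro sum.cong refl)
      fix j assume j: "j \<in> {1..N}"
      have "1 / (u * v) = (1 / u + 1 / v) / (u + v)" if "u > 0" "v > 0" for u v :: real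
      proof -
        have "1 / u + 1 / v = (u + v) / (u * v)" using that by (simp add: field_simps)
        then show ?thesis using that by simp
      qed
      from this[of "real j" "real (N + 1 - j)"] j
      show "1 / (real j * real (N + 1 - j)) = (1 / real j + 1 / real (N + 1 - j)) / real (N + 1)"
        by (simp flip: of_nat_add)
    qed
    also have "\<dots> = ((\<Sum>j = 1..N. 1 / real j) + (\<Sum>j = 1..N. 1 / real (N + 1 - j))) / real (N + 1)"
      by (simp add: sum.distrib flip: sum_divide_distrib)
    also have "(\<Sum>j = 1..N. 1 / real (N + 1 - j)) = (\<Sum>j = 1..N. 1 / real j)"
      by (rule sum.reindex_bij_witness[of _ "\<lambda>j. N + 1 - j" "\<lambda>j. N + 1 - j"]) auto
    also have "((\<Sum>j = 1..N. 1 / real j) + (\<Sum>j = 1..N. 1 / real j)) / real (N + 1)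
        \<le> (2 * sqrt (real N) + 2 * sqrt (real N)) / real (N + 1)"
      by (intro divide_right_mono add_mono sum_inverse_le_sqrt) auto
    finally show ?thesis by simp
  qed
  then show "\<forall>\<^sub>F N in sequentially. convsum N \<le> 4 * sqrt (real N) / real (N + 1)"
    by simp
  show "(\<lambda>N. 4 * sqrt (real N) / real (N + 1)) \<longlonglongrightarrow> 0"
    by real_asymp
  have "0 \<le> convsum N" for N
    unfolding convsum_def
    by (intro sum_nonneg divide_nonneg_nonneg mult_nonneg_nonneg of_nat_0_le_iff zero_le_one)
  then show "\<forall>\<^sub>F N in sequentially. 0 \<le> convsum N"
    by simp
qed auto

section \<open>Triangular versus square truncation of a product\<close>

text \<open>With \<open>j\<close> renamed to the argument of \<open>g\<close>, the difference runs
  over the corner \<open>n > N - j\<close> of the square, where \<open>f n\<close> is at most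
  \<open>1 / (N + 1 - j)\<close> in absolute value.\<close>

lemma triangle_bound_right:
  fixes f g :: "nat \<Rightarrow> real"
  assumes "\<And>n. n \<ge> 1 \<Longrightarrow> \<bar>f n\<bar> \<le> 1 / real n" "\<And>n. n \<ge> 1 \<Longrightarrow> \<bar>g n\<bar> \<le> 1 / real n ^ 2"
  shows "\<bar>(\<Sum>j = 1..N. \<Sum>n = 1..<j. f n * g (j - n)) - sum f {1..N} * sum g {1..N}\<bar> \<le> convsum N"
proof -
  have "(\<Sum>j = 1..N. \<Sum>n = 1..<j. f n * g (j - n)) = (\<Sum>j = 1..N. \<Sum>n = 1..N - j. f n * g j)"
    using sum_offset_triangle[of "\<lambda>a m. f a * g (m - a)" N] by simp
  moreover have "sum f {1..N} * sum g {1..N} = (\<Sum>j = 1..N. \<Sum>n = 1..N. f n * g j)"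
    by (simp add: sum_distrib_left sum_distrib_right)
  moreover have "(\<Sum>j = 1..N. \<Sum>n = 1..N. f n * g j)
      = (\<Sum>j = 1..N. (\<Sum>n = 1..N - j. f n * g j) + (\<Sum>n = N - j + 1..N. f n * g j))"
  proof (intro sum.cong refl)
    fix j assume "j \<in> {1..N}"
    then show "(\<Sum>n = 1..N. f n * g j)
        = (\<Sum>n = 1..N - j. f n * g j) + (\<Sum>n = N - j + 1..N. f n * g j)"
      using sum.ub_add_nat[of 1 "N - j" "\<lambda>n. f n * g j" j] by simp
  qed
  ultimately have "\<bar>(\<Sum>j = 1..N. \<Sum>n = 1..<j. f n * g (j - n)) - sum f {1..N} * sum g {1..N}\<bar>
      = \<bar>\<Sum>j = 1..N. \<Sum>n = N - j + 1..N. f n * g j\<bar>"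
    by (simp add: sum.distrib)
  also have "\<dots> \<le> (\<Sum>j = 1..N. \<Sum>n = N - j + 1..N. \<bar>f n * g j\<bar>)"
    by (intro order.trans[OF sum_abs] sum_mono) auto
  also have "\<dots> \<le> (\<Sum>j = 1..N. \<Sum>n = N - j + 1..N. 1 / real (N + 1 - j) * (1 / real j ^ 2))"
  proof (intro sum_mono)
    fix j n assume jn: "j \<in> {1..N}" "n \<in> {N - j + 1..N}"
    have "\<bar>f n\<bar> \<le> 1 / real n" using assms(1) jn by auto
    also have "\<dots> \<le> 1 / real (N + 1 - j)"
      using jn by (intro divide_left_mono) auto
    finally show "\<bar>f n * g j\<bar> \<le> 1 / real (N + 1 - j) * (1 / real j ^ 2)"
      unfolding abs_mult using assms(2) jn by (intro mult_mono) auto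
  qed
  \<comment> \<open>The inner sum has \<open>j\<close> equal terms, which turns
    \<open>1 / j ^ 2\<close> into \<open>1 / j\<close>.\<close>
  also have "\<dots> = convsum N"
    unfolding convsum_def by (intro sum.cong) (auto simp: power2_eq_square)
  finally show ?thesis .
qed

text \<open>One of the exponents is at least \<open>2\<close>; the reflection
  \<open>n \<mapsto> j - n\<close> moves that factor to the right.\<close>

lemma triangle_bound:
  fixes f g :: "nat \<Rightarrow> real"
  assumes "\<And>n. n \<ge> 1 \<Longrightarrow> \<bar>f n\<bar> \<le> 1 / real n ^ p" "\<And>n. n \<ge> 1 \<Longrightarrow> \<bar>g n\<bar> \<le> 1 / real n ^ q"
    and "p \<ge> 1" "q \<ge> 1" "p + q \<ge> 3"
  shows "\<bar>(\<Sum>j = 1..N. \<Sum>n = 1..<j. f n * g (j - n)) - sum f {1..N} * sum g {1..N}\<bar> \<le> convsum N"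
proof -
  have le: "1 / real n ^ b \<le> 1 / real n ^ a" if "n \<ge> 1" "a \<le> b" for a b n
    using that by (intro divide_left_mono power_increasing) auto
  have f: "\<bar>f n\<bar> \<le> 1 / real n ^ a" if "n \<ge> 1" "a \<le> p" for n a
    using order.trans[OF assms(1) le] that by blast
  have g: "\<bar>g n\<bar> \<le> 1 / real n ^ a" if "n \<ge> 1" "a \<le> q" for n a
    using order.trans[OF assms(2) le] that by blast
  show ?thesis
  proof (cases "q \<ge> 2")
    case True
    then show ?thesis
      using f[of _ 1] g[of _ 2] assms(3) by (intro triangle_bound_right) auto
  next
    case False
    have "(\<Sum>n = 1..<j. f n * g (j - n)) = (\<Sum>n = 1..<j. g n * f (j - n))" for j
      by (rule sum.reindex_bij_witness[of _ "\<lambda>n. j - n" "\<lambda>n. j - n"]) auto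
    moreover have "\<bar>(\<Sum>j = 1..N. \<Sum>n = 1..<j. g n * f (j - n)) - sum g {1..N} * sum f {1..N}\<bar>
        \<le> convsum N"
      using f[of _ 2] g[of _ 1] assms False by (intro triangle_bound_right) auto
    ultimately show ?thesis
      by (simp add: mult.commute)
  qed
qed

section \<open>The sum over \<open>n\<close> for a fixed \<open>j\<close>\<close>

lemma zpart_add:
  "zpart x (j + M) i = zpart x j i + (\<Sum>a = 1..M. x ^ (a + j) / real (a + j) ^ i)"
  by (induction M) (simp_all add: zpart_def add_ac)

lemma zpart_split_last:
  assumes "j \<ge> 1"
  shows "zpart x j i = (\<Sum>n = 1..<j. x ^ n / real n ^ i) + x ^ j / real j ^ i"
  using assms unfolding zpart_def by (simp add: sum.last_plus add.commute)

lemma sum_negative_power: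
  "(\<Sum>p = 1..M. x ^ p / (- real p) ^ i) = (- 1) ^ i * zpart x M i"
  by (cases "even i") (simp_all add: zpart_def sum_negf)

text \<open>
  The three sums on the left are the ranges \<open>n = a + j > j\<close>, \<open>n = -p < 0\<close> and \<open>0 < n < j\<close> of
  the sum of \<open>e\<^sup>n / ((j - n)\<^sup>r n\<^sup>s)\<close> over the integers \<open>n \<noteq> 0, j\<close> in \<open>[j - N, N]\<close>, an interval
  invariant under \<open>n \<mapsto> j - n\<close>.
\<close>

lemma slice_identity:
  fixes e :: real
  assumes e: "e = 1 \<or> e = - 1" and "r \<ge> 1" "s \<ge> 1" "k = r + s" "1 \<le> j" "j \<le> N"
  shows "(- 1) ^ r * (\<Sum>a = 1..N - j. e ^ (a + j) / (real a ^ r * real (a + j) ^ s))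
      + (- 1) ^ s * (\<Sum>p = 1..N - j. e ^ p / (real (p + j) ^ r * real p ^ s))
      + (\<Sum>n = 1..<j. e ^ n / (real (j - n) ^ r * real n ^ s))
    = (\<Sum>i = 1..k - 1. (real ((k - i - 1) choose (r - 1)) + e ^ j * real ((k - i - 1) choose (s - 1)))
        * (zpart e N i - e ^ j / real j ^ i + (- 1) ^ i * zpart e (N - j) i) / real j ^ (k - i))"
    (is "?A + ?B + ?C = (\<Sum>i = 1..k - 1. (?c i + e ^ j * ?d i) * ?T i / _)")
proof -
  obtain M where M: "N = j + M" using assms le_Suc_ex by blast
  \<comment> \<open>\<open>W (j - n) n i\<close> is the part of pole order \<open>i\<close> at the
    point \<open>n\<close>. The arguments always add up to \<open>j\<close>, so
    \<open>1 / j ^ (k - i)\<close> is common to all \<open>n\<close>.\<close>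
  define W where "W a b i = (?c i / b ^ i + ?d i / a ^ i) / real j ^ (k - i)" for a b :: real and i
  have pf: "1 / (a ^ r * b ^ s) = (\<Sum>i = 1..k - 1. W a b i)"
    if "a + b = real j" "a \<noteq> 0" "b \<noteq> 0" for a b
    unfolding W_def using that assms by (intro partial_fractions) auto
  have minus: "1 / (- z) ^ n = (- 1) ^ n / z ^ n" for n and z :: real
    by (cases "even n") auto
  have A: "?A = (\<Sum>a = 1..M. e ^ (a + j) * (\<Sum>i = 1..k - 1. W (- real a) (real (a + j)) i))"
    unfolding sum_distrib_left[of "(- 1) ^ r"] M diff_add_inverse
  proof (intro sum.cong refl)
    fix a assume "a \<in> {1..M}"
    then have "(\<Sum>i = 1..k - 1. W (- real a) (real (a + j)) i)
        = 1 / (- real a) ^ r * (1 / real (a + j) ^ s)"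
      by (subst pf[symmetric]) auto
    then show "(- 1) ^ r * (e ^ (a + j) / (real a ^ r * real (a + j) ^ s))
        = e ^ (a + j) * (\<Sum>i = 1..k - 1. W (- real a) (real (a + j)) i)"
      unfolding minus by simp
  qed
  have B: "?B = (\<Sum>p = 1..M. e ^ p * (\<Sum>i = 1..k - 1. W (real (p + j)) (- real p) i))"
    unfolding sum_distrib_left[of "(- 1) ^ s"] M diff_add_inverse
  proof (intro sum.cong refl)
    fix p assume "p \<in> {1..M}"
    then have "(\<Sum>i = 1..k - 1. W (real (p + j)) (- real p) i)
        = 1 / real (p + j) ^ r * (1 / (- real p) ^ s)"
      by (subst pf[symmetric]) auto
    then show "(- 1) ^ s * (e ^ p / (real (p + j) ^ r * real p ^ s))
        = e ^ p * (\<Sum>i = 1..k - 1. W (real (p + j)) (- real p) i)"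
      unfolding minus by simp
  qed
  have C: "?C = (\<Sum>n = 1..<j. e ^ n * (\<Sum>i = 1..k - 1. W (real (j - n)) (real n) i))"
    by (intro sum.cong refl, subst pf[symmetric]) auto
  have sq: "e ^ n * e ^ n = 1" for n
    using e by (auto simp flip: power_mult_distrib)
  have sq': "e ^ n * (e ^ n * z) = z" for n z
    by (simp add: sq flip: mult.assoc)
  \<comment> \<open>The sum of \<open>e ^ n / n ^ i\<close> over the interval: positive
    \<open>n\<close> give \<open>zpart e N i\<close> without \<open>n = j\<close>, negative ones the
    term with \<open>(- 1) ^ i\<close>.\<close>
  have T1: "(\<Sum>a = 1..M. e ^ (a + j) / real (a + j) ^ i) + (\<Sum>p = 1..M. e ^ p / (- real p) ^ i)
      + (\<Sum>n = 1..<j. e ^ n / real n ^ i) = ?T i" for i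
    unfolding sum_negative_power M zpart_add zpart_split_last[OF \<open>1 \<le> j\<close>] by simp
  \<comment> \<open>The reflection \<open>n \<mapsto> j - n\<close> exchanges the two outer ranges
    and preserves the middle one; since \<open>e\<close> is a sign,
    \<open>e ^ (j - n) = e ^ j * e ^ n\<close> for \<open>n < j\<close>, and likewise on the outer
    ranges.\<close>
  have T2: "(\<Sum>a = 1..M. e ^ (a + j) / (- real a) ^ i) + (\<Sum>p = 1..M. e ^ p / real (p + j) ^ i)
      + (\<Sum>n = 1..<j. e ^ n / real (j - n) ^ i) = e ^ j * ?T i" for i
  proof -
    have "(\<Sum>a = 1..M. e ^ (a + j) / (- real a) ^ i) = e ^ j * (\<Sum>a = 1..M. e ^ a / (- real a) ^ i)"
      by (simp add: sum_distrib_left power_add mult_ac)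
    moreover have "(\<Sum>p = 1..M. e ^ p / real (p + j) ^ i)
        = e ^ j * (\<Sum>a = 1..M. e ^ (a + j) / real (a + j) ^ i)"
      by (simp add: sum_distrib_left power_add mult_ac sq sq')
    moreover have "(\<Sum>n = 1..<j. e ^ n / real (j - n) ^ i) = e ^ j * (\<Sum>n = 1..<j. e ^ n / real n ^ i)"
      unfolding sum_distrib_left
    proof (rule sum.reindex_bij_witness[of _ "\<lambda>n. j - n" "\<lambda>n. j - n"])
      fix n assume n: "n \<in> {1..<j}"
      then have "e ^ j = e ^ n * e ^ (j - n)" by (simp flip: power_add)
      then show "e ^ j * (e ^ (j - n) / real (j - n) ^ i) = e ^ n / real (j - n) ^ i"
        by (simp add: mult.assoc sq)
    qed auto
    ultimately show ?thesis
      unfolding T1[symmetric] by (simp add: algebra_simps)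
  qed
  have "?A + ?B + ?C = (\<Sum>i = 1..k - 1. (\<Sum>a = 1..M. e ^ (a + j) * W (- real a) (real (a + j)) i)
      + (\<Sum>p = 1..M. e ^ p * W (real (p + j)) (- real p) i)
      + (\<Sum>n = 1..<j. e ^ n * W (real (j - n)) (real n) i))"
    unfolding A B C unfolding sum_distrib_left sum.distrib
    by (intro arg_cong2[where f = "(+)"] sum.swap)
  also have "\<dots> = (\<Sum>i = 1..k - 1. (?c i + e ^ j * ?d i) * ?T i / real j ^ (k - i))"
  proof (intro sum.cong refl)
    fix i
    have W: "(\<Sum>n\<in>S. u n * W (a n) (b n) i) = (?c i * (\<Sum>n\<in>S. u n / b n ^ i)
       + ?d i * (\<Sum>n\<in>S. u n / a n ^ i)) / real j ^ (k - i)" for S :: "nat set" and u a b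
      by (simp add: W_def sum_distrib_left sum_distrib_right sum.distrib sum_divide_distrib add_divide_distrib
          distrib_left mult_ac)
    show "(\<Sum>a = 1..M. e ^ (a + j) * W (- real a) (real (a + j)) i)
      + (\<Sum>p = 1..M. e ^ p * W (real (p + j)) (- real p) i)
      + (\<Sum>n = 1..<j. e ^ n * W (real (j - n)) (real n) i)
      = (?c i + e ^ j * ?d i) * ?T i / real j ^ (k - i)" (is "?L = _")
    proof -
      have "?L = (?c i * ((\<Sum>a = 1..M. e ^ (a + j) / real (a + j) ^ i)
          + (\<Sum>p = 1..M. e ^ p / (- real p) ^ i) + (\<Sum>n = 1..<j. e ^ n / real n ^ i))
        + ?d i * ((\<Sum>a = 1..M. e ^ (a + j) / (- real a) ^ i)
          + (\<Sum>p = 1..M. e ^ p / real (p + j) ^ i) + (\<Sum>n = 1..<j. e ^ n / real (j - n) ^ i)))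
        / real j ^ (k - i)"
        unfolding W by (simp only: add_divide_distrib distrib_left add_ac)
      then show ?thesis
        unfolding T1 T2 by (simp add: algebra_simps)
    qed
  qed
  finally show ?thesis .
qed

section \<open>Even zeta values and truncation errors\<close>

text \<open>For \<open>i \<ge> 1\<close>, the value of the symmetric sum of
  \<open>e ^ n / n ^ i\<close> over all integers \<open>n \<noteq> 0\<close>: opposite terms cancel
  for odd \<open>i\<close> and agree for even \<open>i\<close>.\<close>

definition zeven :: "real \<Rightarrow> nat \<Rightarrow> real" where
  "zeven e i = (if even i then 2 * zlim e i else 0)"

lemma slice_error_bound:
  assumes e: "e = 1 \<or> e = - 1" and "odd k" "1 \<le> i" "i < k" "1 \<le> j" "j \<le> N"
  shows "\<bar>zpart e N i + (- 1) ^ i * zpart e (N - j) i - zeven e i\<bar> / real j ^ (k - i)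
    \<le> 4 / (real j * real (N + 1 - j))"
proof (cases "even i")
  case True
  then have "i \<ge> 2" using \<open>1 \<le> i\<close> by presburger
  have "\<bar>zpart e N i - zlim e i\<bar> \<le> 2 / real (N + 1)"
    using e \<open>i \<ge> 2\<close> by (rule zpart_tail_bound)
  also have "\<dots> \<le> 2 / real (N + 1 - j)"
    using assms by (intro divide_left_mono) auto
  finally have "\<bar>zpart e N i - zlim e i\<bar> \<le> 2 / real (N + 1 - j)" .
  moreover have "\<bar>zpart e (N - j) i - zlim e i\<bar> \<le> 2 / real (N - j + 1)"
    using e \<open>i \<ge> 2\<close> by (rule zpart_tail_bound)
  ultimately have "\<bar>zpart e N i + (- 1) ^ i * zpart e (N - j) i - zeven e i\<bar> \<le> 4 / real (N + 1 - j)"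
    using True assms by (simp add: zeven_def Suc_diff_le)
  moreover have "real j ^ 1 \<le> real j ^ (k - i)"
    using assms by (intro power_increasing) auto
  ultimately have "\<bar>zpart e N i + (- 1) ^ i * zpart e (N - j) i - zeven e i\<bar> / real j ^ (k - i)
     \<le> (4 / real (N + 1 - j)) / real j"
    using assms by (intro frac_le) auto
  then show ?thesis by (simp add: mult.commute)
next
  case False
  then have "k - i \<ge> 2" using \<open>odd k\<close> \<open>i < k\<close> by presburger
  obtain M where M: "N = M + j" using assms le_Suc_ex by (metis add.commute)
  have "\<bar>zpart e N i + (- 1) ^ i * zpart e (N - j) i - zeven e i\<bar>
      = \<bar>\<Sum>a = 1..j. e ^ (a + M) / real (a + M) ^ i\<bar>"
    using False by (simp add: M zpart_add zeven_def)
  also have "\<dots> \<le> (\<Sum>a = 1..j. 1 / real (M + 1))"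
  proof (rule order.trans[OF sum_abs sum_mono])
    fix a assume a: "a \<in> {1..j}"
    have "real (M + 1) ^ 1 \<le> real (a + M) ^ 1"
      using a by simp
    also have "\<dots> \<le> real (a + M) ^ i"
      using a assms by (intro power_increasing) auto
    finally have "1 / real (a + M) ^ i \<le> 1 / real (M + 1)"
      using a by (intro divide_left_mono) auto
    then show "\<bar>e ^ (a + M) / real (a + M) ^ i\<bar> \<le> 1 / real (M + 1)"
      using e by (auto simp: power_abs)
  qed
  also have "\<dots> \<le> 4 * (real j / real (M + 1))"
    by (simp add: divide_right_mono)
  finally have "\<bar>zpart e N i + (- 1) ^ i * zpart e (N - j) i - zeven e i\<bar>
    \<le> 4 * (real j / real (M + 1))" .
  moreover have "real j ^ 2 \<le> real j ^ (k - i)"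
    using assms \<open>k - i \<ge> 2\<close> by (intro power_increasing) auto
  ultimately have "\<bar>zpart e N i + (- 1) ^ i * zpart e (N - j) i - zeven e i\<bar> / real j ^ (k - i)
     \<le> 4 * (real j / real (M + 1)) / real j ^ 2"
    using assms by (intro frac_le) auto
  also have "\<dots> = 4 / (real j * real (N + 1 - j))"
    using assms by (simp add: M power2_eq_square)
  finally show ?thesis .
qed

text \<open>The hockey-stick identity; it evaluates the coefficients coming from the excluded points
  \<open>n = j\<close>.\<close>

lemma sum_choose_reversed:
  assumes "k \<ge> 2"
  shows "(\<Sum>i = 1..k - 1. (k - i - 1) choose p) = (k - 1) choose Suc p"
proof -
  have "(\<Sum>i = 1..k - 1. (k - i - 1) choose p) = (\<Sum>t\<le>k - 2. t choose p)"
    by (rule sum.reindex_bij_witness[of _ "\<lambda>t. k - 1 - t" "\<lambda>i. k - 1 - i"]) (use assms in auto)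
  also have "\<dots> = Suc (k - 2) choose Suc p"
    by (rule sum_choose_upper)
  also have "Suc (k - 2) = k - 1" using assms by simp
  finally show ?thesis .
qed

section \<open>Summation over \<open>j\<close>\<close>

text \<open>\<open>slice_identity\<close> with \<open>e = x * y\<close> is weighted by
  \<open>x ^ j\<close>. Since even powers of a sign are \<open>1\<close>, the weights on the three
  ranges become \<open>x ^ a * y ^ (a + j)\<close>, \<open>y ^ p * x ^ (p + j)\<close> and
  \<open>y ^ n * x ^ (j - n)\<close>.\<close>

lemma sum_slice_identity:
  assumes x: "x = 1 \<or> x = - 1" and y: "y = 1 \<or> y = - 1"
    and rs: "r \<ge> 1" "s \<ge> 1" "k = r + s"
  shows "(- 1) ^ r * dpart x r y s N + (- 1) ^ s * dpart y s x r N
      + (\<Sum>j = 1..N. \<Sum>n = 1..<j. y ^ n / real n ^ s * (x ^ (j - n) / real (j - n) ^ r))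
    = (\<Sum>j = 1..N. \<Sum>i = 1..k - 1.
        (x ^ j * real ((k - i - 1) choose (r - 1)) + y ^ j * real ((k - i - 1) choose (s - 1)))
        * (zpart (x * y) N i - (x * y) ^ j / real j ^ i + (- 1) ^ i * zpart (x * y) (N - j) i)
        / real j ^ (k - i))"
proof -
  define e where "e = x * y"
  have e: "e = 1 \<or> e = - 1" using x y by (auto simp: e_def)
  have x2: "x ^ n * x ^ n = 1" for n
    using x by (auto simp flip: power_mult_distrib)
  have x2': "x ^ n * (x ^ n * z) = z" for n z
    by (simp add: x2 flip: mult.assoc)
  have A: "(\<Sum>j = 1..N. x ^ j * (\<Sum>a = 1..N - j. e ^ (a + j) / (real a ^ r * real (a + j) ^ s)))
      = dpart x r y s N"
    using sum_offset_triangle[of "\<lambda>a m. x ^ a / real a ^ r * (y ^ m / real m ^ s)" N]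
    by (simp add: dpart_def e_def sum_distrib_left power_mult_distrib power_add x2' mult_ac)
  have B: "(\<Sum>j = 1..N. x ^ j * (\<Sum>p = 1..N - j. e ^ p / (real (p + j) ^ r * real p ^ s)))
      = dpart y s x r N"
    using sum_offset_triangle[of "\<lambda>a m. y ^ a / real a ^ s * (x ^ m / real m ^ r)" N]
    by (simp add: dpart_def e_def sum_distrib_left power_mult_distrib power_add x2' mult_ac)
  have C: "x ^ j * (\<Sum>n = 1..<j. e ^ n / (real (j - n) ^ r * real n ^ s))
      = (\<Sum>n = 1..<j. y ^ n / real n ^ s * (x ^ (j - n) / real (j - n) ^ r))" for j
    unfolding sum_distrib_left
  proof (intro sum.cong refl)
    fix n assume "n \<in> {1..<j}"
    then have "x ^ j = x ^ n * x ^ (j - n)" by (simp flip: power_add)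
    then have "x ^ j * e ^ n = y ^ n * x ^ (j - n)"
      by (simp add: e_def power_mult_distrib x2' mult_ac)
    then show "x ^ j * (e ^ n / (real (j - n) ^ r * real n ^ s))
        = y ^ n / real n ^ s * (x ^ (j - n) / real (j - n) ^ r)"
      by (simp add: mult_ac)
  qed
  have xe: "x ^ j * e ^ j = y ^ j" for j
    by (simp add: e_def power_mult_distrib x2')
  have "(- 1) ^ r * dpart x r y s N + (- 1) ^ s * dpart y s x r N
      + (\<Sum>j = 1..N. \<Sum>n = 1..<j. y ^ n / real n ^ s * (x ^ (j - n) / real (j - n) ^ r))
    = (\<Sum>j = 1..N. x ^ j *
        ((- 1) ^ r * (\<Sum>a = 1..N - j. e ^ (a + j) / (real a ^ r * real (a + j) ^ s))
      + (- 1) ^ s * (\<Sum>p = 1..N - j. e ^ p / (real (p + j) ^ r * real p ^ s))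
      + (\<Sum>n = 1..<j. e ^ n / (real (j - n) ^ r * real n ^ s))))"
    unfolding A[symmetric] B[symmetric] C[symmetric]
    by (simp only: distrib_left sum.distrib sum_distrib_left[of "(- 1) ^ _" _ "{1..N}"]
        mult.left_commute[of "(- 1) ^ _"])
  also have "\<dots> = (\<Sum>j = 1..N. x ^ j * (\<Sum>i = 1..k - 1.
        (real ((k - i - 1) choose (r - 1)) + e ^ j * real ((k - i - 1) choose (s - 1)))
        * (zpart e N i - e ^ j / real j ^ i + (- 1) ^ i * zpart e (N - j) i) / real j ^ (k - i)))"
    by (intro sum.cong refl arg_cong2[where f = "(*)"] slice_identity e rs) auto
  also have "\<dots> = (\<Sum>j = 1..N. \<Sum>i = 1..k - 1.
        (x ^ j * real ((k - i - 1) choose (r - 1)) + y ^ j * real ((k - i - 1) choose (s - 1)))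
        * (zpart e N i - e ^ j / real j ^ i + (- 1) ^ i * zpart e (N - j) i) / real j ^ (k - i))"
    unfolding sum_distrib_left xe[symmetric] by (simp add: algebra_simps)
  finally show ?thesis unfolding e_def .
qed

lemma sum_even_indices:
  fixes f :: "nat \<Rightarrow> real"
  shows "(\<Sum>i = 1..2 * h. if even i then f i else 0) = (\<Sum>l = 1..h. f (2 * l))"
  by (induction h) simp_all

lemma sum_zeven_eq:
  assumes "odd k"
  shows "(\<Sum>i = 1..k - 1. f i * zeven e i) = 2 * (\<Sum>l = 1..(k - 1) div 2. f (2 * l) * zlim e (2 * l))"
proof -
  have "2 * ((k - 1) div 2) = k - 1" using assms by simp
  then have "(\<Sum>i = 1..k - 1. f i * zeven e i)
      = (\<Sum>i = 1..2 * ((k - 1) div 2). if even i then f i * (2 * zlim e i) else 0)"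
    by (intro sum.cong) (auto simp: zeven_def)
  also have "\<dots> = 2 * (\<Sum>l = 1..(k - 1) div 2. f (2 * l) * zlim e (2 * l))"
    unfolding sum_even_indices by (simp add: sum_distrib_left mult_ac)
  finally show ?thesis .
qed

section \<open>Asymptotics of the truncated double sums\<close>

text \<open>Only a difference is claimed to converge, because \<open>main\<close> may contain the
  divergent sum \<open>zpart 1 N 1\<close>. This lets the case \<open>r = 1\<close> of an unbarred
  inner argument start from the same statement.\<close>

lemma dpart_asymptotics:
  assumes x: "x = 1 \<or> x = - 1" and y: "y = 1 \<or> y = - 1"
    and rs: "r \<ge> 1" "s \<ge> 1" "k = r + s" "k \<ge> 3" "odd k"
  defines "main \<equiv> \<lambda>N. (1 + (- 1) ^ s) * (zpart x N r * zpart y N s) - zpart (x * y) N k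
      + (- 1) ^ r * (2 * (\<Sum>l = 0..(k - 1) div 2.
          (real ((k - 2 * l - 1) choose (r - 1)) * zpart x N (k - 2 * l)
         + real ((k - 2 * l - 1) choose (s - 1)) * zpart y N (k - 2 * l)) * zlim (x * y) (2 * l)))"
  shows "(\<lambda>N. 2 * dpart x r y s N - main N) \<longlonglongrightarrow> 0"
proof -
  define e where "e = x * y"
  have e: "e = 1 \<or> e = - 1" using x y by (auto simp: e_def)
  define c d where "c i = real ((k - i - 1) choose (r - 1))"
    and "d i = real ((k - i - 1) choose (s - 1))" for i
  define tri where "tri N = (\<Sum>j = 1..N. \<Sum>n = 1..<j. y ^ n / real n ^ s * (x ^ (j - n) / real (j - n) ^ r))" for N
  define R where "R N i j = zpart e N i + (- 1) ^ i * zpart e (N - j) i - zeven e i" for N i j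
  define err where "err N = (\<Sum>j = 1..N. \<Sum>i = 1..k - 1. (x ^ j * c i + y ^ j * d i) * R N i j / real j ^ (k - i))" for N
  define S where "S N = (\<Sum>l = 0..(k - 1) div 2. (c (2 * l) * zpart x N (k - 2 * l)
      + d (2 * l) * zpart y N (k - 2 * l)) * zlim e (2 * l))" for N
  define K where "K = (\<Sum>i = 1..k - 1. 4 * (c i + d i))"
  have cd: "c i \<ge> 0" "d i \<ge> 0" for i by (simp_all add: c_def d_def)
  have abs1: "\<bar>x ^ j\<bar> = 1" "\<bar>y ^ j\<bar> = 1" for j
    using x y by (auto simp: power_abs)
  have xe: "x ^ j * e ^ j = y ^ j" "y ^ j * e ^ j = x ^ j" for j
    using x y by (auto simp: e_def)
  have slice: "(- 1) ^ r * dpart x r y s N + (- 1) ^ s * dpart y s x r N + tri N = 2 * S N + err N" for N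
  proof -
    have "(x ^ j * c i + y ^ j * d i) * (zpart e N i - e ^ j / real j ^ i + (- 1) ^ i * zpart e (N - j) i)
          / real j ^ (k - i)
        = (x ^ j / real j ^ (k - i) * c i + y ^ j / real j ^ (k - i) * d i) * zeven e i
          - (y ^ j / real j ^ k * c i + x ^ j / real j ^ k * d i)
          + (x ^ j * c i + y ^ j * d i) * R N i j / real j ^ (k - i)"
      if "i \<in> {1..k - 1}" "j \<in> {1..N}" for i j
    proof -
      have "i + (k - i) = k" using that rs by auto
      then have "real j ^ k = real j ^ i * real j ^ (k - i)"
        by (metis power_add)
      moreover have "(x ^ j * c i + y ^ j * d i) * e ^ j = (x ^ j * e ^ j) * c i + (y ^ j * e ^ j) * d i"
        by (simp add: algebra_simps)
      ultimately have "(x ^ j * c i + y ^ j * d i) * (e ^ j / real j ^ i) / real j ^ (k - i)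
        = y ^ j / real j ^ k * c i + x ^ j / real j ^ k * d i"
        unfolding xe by (simp add: add_divide_distrib)
      moreover have "zpart e N i - e ^ j / real j ^ i + (- 1) ^ i * zpart e (N - j) i
        = zeven e i - e ^ j / real j ^ i + R N i j"
        by (simp add: R_def)
      ultimately show ?thesis
        by (simp only: distrib_left right_diff_distrib add_divide_distrib diff_divide_distrib)
          (simp add: add_divide_distrib distrib_left distrib_right mult_ac)
    qed
    then have "(- 1) ^ r * dpart x r y s N + (- 1) ^ s * dpart y s x r N + tri N
      = (\<Sum>j = 1..N. \<Sum>i = 1..k - 1.
          (x ^ j / real j ^ (k - i) * c i + y ^ j / real j ^ (k - i) * d i) * zeven e i
          - (y ^ j / real j ^ k * c i + x ^ j / real j ^ k * d i)
          + (x ^ j * c i + y ^ j * d i) * R N i j / real j ^ (k - i))"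
      using sum_slice_identity[OF x y rs(1-3), of N]
      unfolding tri_def c_def d_def e_def by (simp only:) (intro sum.cong refl, simp)
    also have "\<dots> = (\<Sum>j = 1..N. \<Sum>i = 1..k - 1.
          (x ^ j / real j ^ (k - i) * c i + y ^ j / real j ^ (k - i) * d i) * zeven e i)
        - (\<Sum>j = 1..N. \<Sum>i = 1..k - 1. y ^ j / real j ^ k * c i + x ^ j / real j ^ k * d i)
        + err N"
      unfolding err_def by (simp only: sum.distrib sum_subtractf)
    also have "(\<Sum>j = 1..N. \<Sum>i = 1..k - 1.
          (x ^ j / real j ^ (k - i) * c i + y ^ j / real j ^ (k - i) * d i) * zeven e i)
        = (\<Sum>i = 1..k - 1. (c i * zpart x N (k - i) + d i * zpart y N (k - i)) * zeven e i)"
      by (subst sum.swap)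
        (simp add: zpart_def sum_distrib_left sum_distrib_right sum.distrib distrib_right distrib_left mult_ac)
    also have "(\<Sum>j = 1..N. \<Sum>i = 1..k - 1. y ^ j / real j ^ k * c i + x ^ j / real j ^ k * d i)
        = zpart y N k * sum c {1..k - 1} + zpart x N k * sum d {1..k - 1}"
      by (simp add: zpart_def sum.distrib sum_product)
    \<comment> \<open>The coefficients cross over by the symmetry of \<open>k - 1 choose r\<close>.
      Subtracting the terms of the excluded points therefore amounts to adding twice the summand
      \<open>l = 0\<close> of \<open>S N\<close>, where \<open>zlim e 0 = - 1 / 2\<close>.\<close>
    also have "sum c {1..k - 1} = d 0"
    proof -
      have "sum c {1..k - 1} = real ((k - 1) choose r)"
        using sum_choose_reversed[of k "r - 1"] rs unfolding c_def by (simp flip: of_nat_sum)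
      also have "(k - 1) choose r = (k - 1) choose (s - 1)"
        using rs binomial_symmetric[of r "k - 1"] by simp
      finally show ?thesis by (simp add: d_def)
    qed
    also have "sum d {1..k - 1} = c 0"
    proof -
      have "sum d {1..k - 1} = real ((k - 1) choose s)"
        using sum_choose_reversed[of k "s - 1"] rs unfolding d_def by (simp flip: of_nat_sum)
      also have "(k - 1) choose s = (k - 1) choose (r - 1)"
        using rs binomial_symmetric[of s "k - 1"] by simp
      finally show ?thesis by (simp add: c_def)
    qed
    finally show ?thesis
      unfolding sum_zeven_eq[OF rs(5)] S_def sum.atLeast_Suc_atMost[OF le0]
      by (simp add: zlim_def algebra_simps)
  qed
  have "\<bar>err N\<bar> \<le> K * convsum N" for N
  proof -
    have "\<bar>err N\<bar> \<le> (\<Sum>j = 1..N. \<Sum>i = 1..k - 1. \<bar>(x ^ j * c i + y ^ j * d i) * R N i j / real j ^ (k - i)\<bar>)"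
      unfolding err_def by (intro order.trans[OF sum_abs] sum_mono) auto
    also have "\<dots> \<le> (\<Sum>j = 1..N. \<Sum>i = 1..k - 1. 4 * (c i + d i) * (1 / (real j * real (N + 1 - j))))"
    proof (intro sum_mono)
      fix i j assume ij: "i \<in> {1..k - 1}" "j \<in> {1..N}"
      have "\<bar>x ^ j * c i + y ^ j * d i\<bar> \<le> c i + d i"
        using cd[of i] by (intro order.trans[OF abs_triangle_ineq]) (simp add: abs_mult abs1)
      moreover have "\<bar>R N i j\<bar> / real j ^ (k - i) \<le> 4 / (real j * real (N + 1 - j))"
        unfolding R_def using ij rs e by (intro slice_error_bound) auto
      ultimately have "\<bar>x ^ j * c i + y ^ j * d i\<bar> * (\<bar>R N i j\<bar> / real j ^ (k - i))
          \<le> (c i + d i) * (4 / (real j * real (N + 1 - j)))"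
        using cd[of i] by (intro mult_mono) auto
      then show "\<bar>(x ^ j * c i + y ^ j * d i) * R N i j / real j ^ (k - i)\<bar>
          \<le> 4 * (c i + d i) * (1 / (real j * real (N + 1 - j)))"
        by (simp add: abs_mult mult_ac)
    qed
    also have "\<dots> = K * convsum N"
      unfolding K_def convsum_def sum_product by (subst sum.swap) simp
    finally show ?thesis .
  qed
  moreover have K0: "(\<lambda>N. K * convsum N) \<longlonglongrightarrow> 0"
    using tendsto_mult_right_zero[OF convsum_tendsto_0] .
  ultimately have err: "err \<longlonglongrightarrow> 0"
    by (intro tendsto_rabs_zero_cancel[OF tendsto_sandwich[OF _ _ tendsto_const K0]]) auto
  \<comment> \<open>\<open>tri N\<close> is the product of the two single sums cut off at total
    index \<open>N\<close>.\<close>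
  have "\<bar>tri N - zpart y N s * zpart x N r\<bar> \<le> convsum N" for N
    unfolding tri_def zpart_def
    by (rule triangle_bound[where p = s and q = r]) (use rs abs1 in auto)
  then have corner: "(\<lambda>N. tri N - zpart y N s * zpart x N r) \<longlonglongrightarrow> 0"
    by (intro tendsto_rabs_zero_cancel[OF tendsto_sandwich[OF _ _ tendsto_const convsum_tendsto_0]]) auto
  \<comment> \<open>The stuffle relation eliminates \<open>dpart y s x r N\<close>. As
    \<open>k\<close> is odd, \<open>(- 1) ^ r\<close> and \<open>(- 1) ^ s\<close> are opposite, so
    the two copies of \<open>dpart x r y s N\<close> add up instead of cancelling.\<close>
  have "2 * dpart x r y s N - main N = (- 1) ^ r * (err N - (tri N - zpart y N s * zpart x N r))" for N
  proof -
    have main: "main N = (1 + (- 1) ^ s) * (zpart x N r * zpart y N s) - zpart e N k + (- 1) ^ r * (2 * S N)"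
      unfolding main_def S_def c_def d_def e_def by simp
    have st: "dpart y s x r N = zpart x N r * zpart y N s - zpart e N k - dpart x r y s N"
      using dpart_stuffle[of x r y s N] rs by (simp add: e_def)
    have "(- 1) ^ r = (1 :: real) \<and> (- 1) ^ s = (- 1 :: real) \<or> (- 1) ^ r = (- 1 :: real) \<and> (- 1) ^ s = (1 :: real)"
      using rs by (cases "even r") auto
    then show ?thesis
      using slice[of N] unfolding main st by (elim disjE conjE) (simp_all add: algebra_simps)
  qed
  then show ?thesis
    using tendsto_mult_right_zero[OF tendsto_diff[OF err corner, simplified]] by simp
qed

section \<open>Passage to the limit\<close>

text \<open>The outer index \<open>m = 1\<close> has an empty inner sum, so truncation at
  \<open>N + 1\<close> matches \<open>N\<close> terms of the series starting at
  \<open>2\<close>.\<close>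

lemma dpart_shift:
  "dpart x r y s (Suc N)
    = (\<Sum>m<N. y ^ (m + 2) / real (m + 2) ^ s * (\<Sum>j = 1..m + 1. x ^ j / real j ^ r))"
  by (induction N) (simp_all add: dpart_def flip: atLeastLessThanSuc_atLeastAtMost)

lemma suminf_eq_dpart_limit:
  assumes "dpart x r y s \<longlonglongrightarrow> L"
  shows "(\<Sum>m. y ^ (m + 2) / real (m + 2) ^ s * (\<Sum>j = 1..m + 1. x ^ j / real j ^ r)) = L"
proof -
  have "(\<lambda>N. dpart x r y s (Suc N)) \<longlonglongrightarrow> L"
    using assms by (rule LIMSEQ_Suc)
  then show ?thesis
    unfolding dpart_shift by (intro sums_unique[symmetric]) (simp only: sums_def)
qed

text \<open>For \<open>n = 1\<close> and \<open>p \<ge> 2\<close> the coefficient is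
  \<open>0\<close>, which disarms a divergent harmonic sum; \<open>n = p = 1\<close> only occurs
  with alternating signs.\<close>

lemma choose_zpart_tendsto:
  assumes "x = 1 \<or> x = - 1" "n \<ge> 1" "p \<ge> 2 \<or> p = 1 \<and> x = - 1"
  shows "(\<lambda>N. real ((n - 1) choose (p - 1)) * zpart x N n)
    \<longlonglongrightarrow> real ((n - 1) choose (p - 1)) * zlim x n"
proof (cases "n = 1 \<and> p \<ge> 2")
  case True
  then show ?thesis by (simp add: binomial_eq_0)
next
  case False
  then show ?thesis
    using assms by (intro tendsto_intros zpart_tendsto) auto
qed

lemma dpart_tendsto:
  assumes x: "x = 1 \<or> x = - 1" and y: "y = 1 \<or> y = - 1"
    and r: "r \<ge> 2 \<or> r = 1 \<and> x = - 1" and s: "s \<ge> 2 \<or> s = 1 \<and> y = - 1"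
    and k: "k = r + s" "k \<ge> 3" "odd k"
  shows "dpart x r y s \<longlonglongrightarrow> - 1 / 2 * zlim (x * y) k
      + (1 + (- 1) ^ s) / 2 * (zlim x r * zlim y s)
      + (- 1) ^ r * (\<Sum>l = 0..(k - 1) div 2.
          (real ((k - 2 * l - 1) choose (r - 1)) * zlim x (k - 2 * l)
         + real ((k - 2 * l - 1) choose (s - 1)) * zlim y (k - 2 * l)) * zlim (x * y) (2 * l))"
    (is "_ \<longlonglongrightarrow> ?L")
proof -
  have xy: "x * y = 1 \<or> x * y = - 1" using x y by auto
  have rs: "r \<ge> 1" "s \<ge> 1" using r s by auto
  have kl: "k - 2 * l \<ge> 1" if "l \<in> {0..(k - 1) div 2}" for l
    using that k by auto
  have "(\<lambda>N. \<Sum>l = 0..(k - 1) div 2.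
          (real ((k - 2 * l - 1) choose (r - 1)) * zpart x N (k - 2 * l)
         + real ((k - 2 * l - 1) choose (s - 1)) * zpart y N (k - 2 * l)) * zlim (x * y) (2 * l))
    \<longlonglongrightarrow> (\<Sum>l = 0..(k - 1) div 2.
          (real ((k - 2 * l - 1) choose (r - 1)) * zlim x (k - 2 * l)
         + real ((k - 2 * l - 1) choose (s - 1)) * zlim y (k - 2 * l)) * zlim (x * y) (2 * l))"
    by (rule tendsto_sum)
      (intro tendsto_mult_right tendsto_add choose_zpart_tendsto x y r s kl; assumption)
  moreover have "(\<lambda>N. zpart (x * y) N k) \<longlonglongrightarrow> zlim (x * y) k"
    using xy k by (intro zpart_tendsto) auto
  moreover have "(\<lambda>N. zpart x N r * zpart y N s) \<longlonglongrightarrow> zlim x r * zlim y s"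
    using x y r s by (intro tendsto_mult zpart_tendsto)
  ultimately have "(\<lambda>N. (1 + (- 1) ^ s) * (zpart x N r * zpart y N s) - zpart (x * y) N k
      + (- 1) ^ r * (2 * (\<Sum>l = 0..(k - 1) div 2.
          (real ((k - 2 * l - 1) choose (r - 1)) * zpart x N (k - 2 * l)
         + real ((k - 2 * l - 1) choose (s - 1)) * zpart y N (k - 2 * l)) * zlim (x * y) (2 * l))))
    \<longlonglongrightarrow> (1 + (- 1) ^ s) * (zlim x r * zlim y s) - zlim (x * y) k
      + (- 1) ^ r * (2 * (\<Sum>l = 0..(k - 1) div 2.
          (real ((k - 2 * l - 1) choose (r - 1)) * zlim x (k - 2 * l)
         + real ((k - 2 * l - 1) choose (s - 1)) * zlim y (k - 2 * l)) * zlim (x * y) (2 * l)))"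
    by (intro tendsto_add tendsto_diff tendsto_mult_left)
  from tendsto_mult[OF tendsto_const[of "1 / 2"] tendsto_add[OF dpart_asymptotics[OF x y rs k] this]]
  show ?thesis
    by (simp add: algebra_simps add_divide_distrib diff_divide_distrib)
qed

text \<open>
  Here the divergent harmonic sum occurs twice, in the product term and in the summand
  \<open>l = (k - 1)/2\<close>, and the two occurrences cancel up to an error of order \<open>N\<^sup>-\<^sup>1\<^sup>/\<^sup>2\<close>.
\<close>

lemma dpart_ub_one_tendsto:
  assumes s: "s \<ge> 2" "even s" and k: "k = 1 + s"
  shows "dpart 1 1 (- 1) s \<longlonglongrightarrow> - 1 / 2 * zlim (- 1) k
      - ((\<Sum>l = 0..(k - 3) div 2. zlim 1 (k - 2 * l) * zlim (- 1) (2 * l))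
       + (\<Sum>l = 0..(k - 1) div 2.
            real ((k - 2 * l - 1) choose (s - 1)) * zlim (- 1) (k - 2 * l) * zlim (- 1) (2 * l)))"
    (is "_ \<longlonglongrightarrow> - 1 / 2 * _ - (?S1 + ?S2)")
proof -
  obtain h where h: "s = 2 * Suc h"
    using s by (elim evenE) (metis Suc_pred gr0I mult_0_right not_numeral_le_zero)
  define P1 where "P1 N = (\<Sum>l = 0..h. zpart 1 N (k - 2 * l) * zlim (- 1) (2 * l))" for N
  define P2 where "P2 N = (\<Sum>l = 0..Suc h. real ((k - 2 * l - 1) choose (s - 1)) * zpart (- 1) N (k - 2 * l)
      * zlim (- 1) (2 * l))" for N
  \<comment> \<open>What remains after the two harmonic terms cancel: a factor of size at most
    \<open>2 * sqrt N\<close> times a tail of order \<open>1 / N\<close>.\<close>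
  define D where "D N = zpart 1 N 1 * (zpart (- 1) N s - zlim (- 1) s)" for N
  have hk: "(k - 3) div 2 = h" "(k - 1) div 2 = Suc h"
    using h k by auto
  have P1: "P1 \<longlonglongrightarrow> ?S1"
    unfolding P1_def hk by (intro tendsto_sum tendsto_mult tendsto_const zpart_tendsto) (use h k in auto)
  have P2: "P2 \<longlonglongrightarrow> ?S2"
    unfolding P2_def hk
    by (intro tendsto_sum tendsto_mult[OF choose_zpart_tendsto] tendsto_const) (use h k in auto)
  have D: "D \<longlonglongrightarrow> 0"
  proof (rule tendsto_rabs_zero_cancel[OF tendsto_sandwich[OF _ _ tendsto_const]])
    have "\<bar>D N\<bar> \<le> 2 * sqrt (real N) * (2 / real (N + 1))" for N
      unfolding D_def abs_mult
      using sum_inverse_le_sqrt[of N] zpart_tail_bound[of "- 1" s N] s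
      by (intro mult_mono) (auto simp: zpart_def sum_nonneg)
    then show "\<forall>\<^sub>F N in sequentially. \<bar>D N\<bar> \<le> 2 * sqrt (real N) * (2 / real (N + 1))"
      by simp
    show "(\<lambda>N. 2 * sqrt (real N) * (2 / real (N + 1))) \<longlonglongrightarrow> 0"
      by real_asymp
  qed auto
  have "(\<lambda>N. 2 * dpart 1 1 (- 1) s N - (2 * (zpart 1 N 1 * zpart (- 1) N s) - zpart (- 1) N k
      - 2 * (P1 N + zpart 1 N 1 * zlim (- 1) s + P2 N))) \<longlonglongrightarrow> 0"
  proof -
    have main: "(1 + (- 1) ^ s) * (zpart 1 N 1 * zpart (- 1) N s) - zpart (1 * - 1) N k
        + (- 1) ^ 1 * (2 * (\<Sum>l = 0..(k - 1) div 2.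
            (real ((k - 2 * l - 1) choose (1 - 1)) * zpart 1 N (k - 2 * l)
           + real ((k - 2 * l - 1) choose (s - 1)) * zpart (- 1) N (k - 2 * l)) * zlim (1 * - 1) (2 * l)))
      = 2 * (zpart 1 N 1 * zpart (- 1) N s) - zpart (- 1) N k
        - 2 * (P1 N + zpart 1 N 1 * zlim (- 1) s + P2 N)" for N
    proof -
      \<comment> \<open>The last summand pairs the harmonic sum with
        \<open>zlim (- 1) s\<close>.\<close>
      have "k - 2 * Suc h = 1" "2 * Suc h = s" using h k by auto
      then have "(\<Sum>l = 0..Suc h. zpart 1 N (k - 2 * l) * zlim (- 1) (2 * l))
          = P1 N + zpart 1 N 1 * zlim (- 1) s"
        unfolding P1_def by (simp only: sum.atLeast0_atMost_Suc)
      then show ?thesis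
        unfolding hk P2_def distrib_right sum.distrib using s by simp
    qed
    have "odd k" "k \<ge> 3" "s \<ge> 1" using s k by auto
    then show ?thesis
      using dpart_asymptotics[of 1 "- 1" 1 s k] k unfolding main by simp
  qed
  then have "(\<lambda>N. 1 / 2 * (2 * dpart 1 1 (- 1) s N - (2 * (zpart 1 N 1 * zpart (- 1) N s) - zpart (- 1) N k
      - 2 * (P1 N + zpart 1 N 1 * zlim (- 1) s + P2 N)))
      + D N - 1 / 2 * zpart (- 1) N k - (P1 N + P2 N))
    \<longlonglongrightarrow> 1 / 2 * 0 + 0 - 1 / 2 * zlim (- 1) k - (?S1 + ?S2)"
    by (intro tendsto_add tendsto_diff tendsto_mult_left D P1 P2 zpart_tendsto) (use s k in auto)
  moreover have "1 / 2 * (2 * dpart 1 1 (- 1) s N - (2 * (zpart 1 N 1 * zpart (- 1) N s) - zpart (- 1) N k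
      - 2 * (P1 N + zpart 1 N 1 * zlim (- 1) s + P2 N)))
      + D N - 1 / 2 * zpart (- 1) N k - (P1 N + P2 N) = dpart 1 1 (- 1) s N" for N
    by (simp add: D_def algebra_simps)
  ultimately show ?thesis by simp
qed

section \<open>The three sign patterns\<close>

theorem theorem2p10:
  fixes r s k :: nat
  assumes "r \<ge> 1" and "s \<ge> 1" and "k = r + s" and "k \<ge> 3" and "odd k"
  shows
    "(s \<ge> 2 \<longrightarrow>
       dzeta_bu r s =
         - 1 / 2 * zeta_bar k + (1 + (- 1) ^ s) / 2 * (zeta_bar r * zeta_val s)
         + (- 1) ^ r * (\<Sum>l = 0..(k - 1) div 2.
             (real ((k - 2 * l - 1) choose (r - 1)) * zeta_bar (k - 2 * l)
              + real ((k - 2 * l - 1) choose (s - 1)) * zeta_val (k - 2 * l)) * zeta_bar (2 * l)))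
     \<and> (r \<ge> 2 \<longrightarrow>
       dzeta_ub r s =
         - 1 / 2 * zeta_bar k + (1 + (- 1) ^ s) / 2 * (zeta_val r * zeta_bar s)
         + (- 1) ^ r * (\<Sum>l = 0..(k - 1) div 2.
             (real ((k - 2 * l - 1) choose (r - 1)) * zeta_val (k - 2 * l)
              + real ((k - 2 * l - 1) choose (s - 1)) * zeta_bar (k - 2 * l)) * zeta_bar (2 * l)))
     \<and> (r = 1 \<longrightarrow>
       dzeta_ub r s =
         - 1 / 2 * zeta_bar k
         + (- 1) ^ r *
           ((\<Sum>l = 0..(k - 3) div 2.
               real ((k - 2 * l - 1) choose (r - 1)) * zeta_val (k - 2 * l) * zeta_bar (2 * l))
            + (\<Sum>l = 0..(k - 1) div 2.
               real ((k - 2 * l - 1) choose (s - 1)) * zeta_bar (k - 2 * l) * zeta_bar (2 * l))))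
     \<and> dzeta_bb r s =
         - 1 / 2 * zeta_val k + (1 + (- 1) ^ s) / 2 * (zeta_bar r * zeta_bar s)
         + (- 1) ^ r * (\<Sum>l = 0..(k - 1) div 2.
             (real ((k - 2 * l - 1) choose (r - 1)) * zeta_bar (k - 2 * l)
              + real ((k - 2 * l - 1) choose (s - 1)) * zeta_bar (k - 2 * l)) * zeta_val (2 * l))"
proof -
  \<comment> \<open>A barred argument may equal \<open>1\<close>, since its sign is
    \<open>- 1\<close>.\<close>
  have bar: "n \<ge> 2 \<or> n = 1 \<and> (- 1 :: real) = - 1" if "n \<ge> 1" for n :: nat
    using that by auto
  note r = bar[OF assms(1)] and s = bar[OF assms(2)] and k = assms(3-5)
  show ?thesis
  proof (intro conjI impI)
    assume "s \<ge> 2"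
    from suminf_eq_dpart_limit[OF dpart_tendsto[OF disjI2[OF refl] disjI1[OF refl] r disjI1[OF this] k]]
    show "dzeta_bu r s =
           - 1 / 2 * zeta_bar k + (1 + (- 1) ^ s) / 2 * (zeta_bar r * zeta_val s)
           + (- 1) ^ r * (\<Sum>l = 0..(k - 1) div 2.
               (real ((k - 2 * l - 1) choose (r - 1)) * zeta_bar (k - 2 * l)
                + real ((k - 2 * l - 1) choose (s - 1)) * zeta_val (k - 2 * l)) * zeta_bar (2 * l))"
      by (simp add: dzeta_bu_def zlim_one zlim_minus_one)
  next
    assume "r \<ge> 2"
    from suminf_eq_dpart_limit[OF dpart_tendsto[OF disjI1[OF refl] disjI2[OF refl] disjI1[OF this] s k]]
    show "dzeta_ub r s =
           - 1 / 2 * zeta_bar k + (1 + (- 1) ^ s) / 2 * (zeta_val r * zeta_bar s)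
           + (- 1) ^ r * (\<Sum>l = 0..(k - 1) div 2.
               (real ((k - 2 * l - 1) choose (r - 1)) * zeta_val (k - 2 * l)
                + real ((k - 2 * l - 1) choose (s - 1)) * zeta_bar (k - 2 * l)) * zeta_bar (2 * l))"
      by (simp add: dzeta_ub_def zlim_one zlim_minus_one)
  next
    assume "r = 1"
    \<comment> \<open>Oddness of \<open>k = 1 + s\<close> makes \<open>s\<close> even.\<close>
    then have "s \<ge> 2" "even s" "k = 1 + s" using k by auto
    from suminf_eq_dpart_limit[OF dpart_ub_one_tendsto[OF this]] \<open>r = 1\<close>
    show "dzeta_ub r s =
           - 1 / 2 * zeta_bar k
           + (- 1) ^ r *
             ((\<Sum>l = 0..(k - 3) div 2.
                 real ((k - 2 * l - 1) choose (r - 1)) * zeta_val (k - 2 * l) * zeta_bar (2 * l))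
              + (\<Sum>l = 0..(k - 1) div 2.
                 real ((k - 2 * l - 1) choose (s - 1)) * zeta_bar (k - 2 * l) * zeta_bar (2 * l)))"
      by (simp add: dzeta_ub_def zlim_one zlim_minus_one)
  next
    from suminf_eq_dpart_limit[OF dpart_tendsto[OF disjI2[OF refl] disjI2[OF refl] r s k]]
    show "dzeta_bb r s =
           - 1 / 2 * zeta_val k + (1 + (- 1) ^ s) / 2 * (zeta_bar r * zeta_bar s)
           + (- 1) ^ r * (\<Sum>l = 0..(k - 1) div 2.
               (real ((k - 2 * l - 1) choose (r - 1)) * zeta_bar (k - 2 * l)
                + real ((k - 2 * l - 1) choose (s - 1)) * zeta_bar (k - 2 * l)) * zeta_val (2 * l))"
      by (simp add: dzeta_bb_def zlim_one zlim_minus_one)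
  qed
qed

end
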